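(* Let $\{K_t\}_{t>0}$ be a family of integrable kernels on $\mathbb{R}^n$, let $f\in L^1_{\mathrm{loc}}(\mathbb{R}^n)$, and let $x$ be a Lebesgue point of $f$ such that $$\lim_{t\to0^+}K_t*f(x)=f(x)\qquad\text{and}\qquad\sup_{t>0}|K_t*f(x)|<\infty .$$ Then, for every $\gamma\in\mathbb{R}\setminus\{0\}$ and $q\in(0,\infty)$, $$|f(x)|=\gamma^{1/q}\lim_{\lambda\to\infty}\lambda\,w_\gamma\left(\left\{t>0:|K_t*f(x)|>\lambda t^{\gamma/q}\right\}\right)^{1/q}\quad\text{if }\gamma>0,$$ $$|f(x)|=(-\gamma)^{1/q}\lim_{\lambda\to0^+}\lambda\,w_\gamma\left(\left\{t>0:|K_t*f(x)|>\lambda t^{\gamma/q}\right\}\right)^{1/q}\quad\text{if }\gamma<0.$$ In particular, if $\sup_{t>0}|K_t*f(x)|\le C_K Mf(x)$ for a constant $C_K$, then $$|f(x)|\le|\gamma|^{1/q}\sup_{\lambda>0}\lambda\,w_\gamma\left(\left\{t>0:|K_t*f(x)|>\lambda t^{\gamma/q}\right\}\right)^{1/q}\le C_KMf(x).$$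
   Context: For $\gamma\ne0$ and measurable $E\subset(0,\infty)$, $w_\gamma(E):=\int_Et^{\gamma-1}\,dt$. $Mf(x):=\sup_{r>0}\frac{1}{|B(x,r)|}\int_{B(x,r)}|f(y)|\,dy$ is the centered Hardy–Littlewood maximal function. $K_t*f$ denotes convolution on $\mathbb{R}^n$. *)

theory Defs
  imports "HOL-Analysis.Analysis"
begin

definition locally_integrable ::
  "('a::euclidean_space \<Rightarrow> 'b::{banach, second_countable_topology}) \<Rightarrow> bool"
  where "locally_integrable f \<longleftrightarrow> (\<forall>C. compact C \<longrightarrow> set_integrable lebesgue C f)"

definition ball_average :: "('a::euclidean_space \<Rightarrow> 'b::real_normed_vector) \<Rightarrow> 'a \<Rightarrow> real \<Rightarrow> ennreal"
  where "ball_average g x r =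
    (\<integral>\<^sup>+ y \<in> ball x r. ennreal (norm (g y)) \<partial>lebesgue) / emeasure lebesgue (ball x r)"

definition lebesgue_point :: "('a::euclidean_space \<Rightarrow> 'b::real_normed_vector) \<Rightarrow> 'a \<Rightarrow> bool"
  where "lebesgue_point f x \<longleftrightarrow> ((\<lambda>r. ball_average (\<lambda>y. f y - f x) x r) \<longlongrightarrow> 0) (at_right 0)"

definition HL_maximal :: "('a::euclidean_space \<Rightarrow> 'b::real_normed_vector) \<Rightarrow> 'a \<Rightarrow> ennreal"
  where "HL_maximal f x = (SUP r \<in> {0<..}. ball_average f x r)"

text \<open>The type class constraints on the values leave exactly the real and the complex scalars.
  As usual for the Bochner integral, the value is 0 at points where the integrand is
  not integrable.\<close>

definition conv :: "('a::euclidean_space \<Rightarrow> 'b) \<Rightarrow> ('a \<Rightarrow> 'b) \<Rightarrow> 'a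
    \<Rightarrow> 'b::{real_normed_field, banach, second_countable_topology}"
  where "conv k f x = (\<integral> y. k (x - y) * f y \<partial>lebesgue)"

text \<open>Meant for sets \<open>E\<close> of positive reals. On non-measurable \<open>E\<close> the nonnegative integral is
  the supremum over the measurable simple functions below the integrand, that is, an
  inner measure.\<close>

definition wmeas :: "real \<Rightarrow> real set \<Rightarrow> ennreal"
  where "wmeas \<gamma> E = (\<integral>\<^sup>+ t \<in> E. ennreal (t powr (\<gamma> - 1)) \<partial>lebesgue)"

text \<open>Real powers on the extended nonnegative reals, for exponents \<open>p > 0\<close>.\<close>

definition ennpowr :: "ennreal \<Rightarrow> real \<Rightarrow> ennreal"
  where "ennpowr a p = (if a = \<infinity> then \<infinity> else ennreal (enn2real a powr p))"

definition weak_quantity :: "real \<Rightarrow> real \<Rightarrow> (real \<Rightarrow> 'b::real_normed_vector) \<Rightarrow> real \<Rightarrow> ennreal"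
  where "weak_quantity \<gamma> q g l =
    ennreal l * ennpowr (wmeas \<gamma> {t. t > 0 \<and> norm (g t) > l * t powr (\<gamma> / q)}) (1 / q)"

end

theory Submission
  imports Defs
begin

text \<open>
  Only the function \<open>g t = K\<^sub>t * f(x)\<close> of one real variable matters; it tends to \<open>f(x)\<close> at \<open>0\<close> and
  is bounded. For a constant \<open>c \<ge> 0\<close> the set \<open>{t > 0. \<lambda> t\<^bsup>\<gamma>/q\<^esup> < c}\<close> is an interval with weighted
  measure exactly \<open>(c/\<lambda>)\<^bsup>q\<^esup> / |\<gamma>|\<close>. For \<open>t < \<delta>\<close> the function \<open>|g|\<close> is within \<open>\<epsilon>\<close> of \<open>|f(x)|\<close>, so the
  superlevel set of \<open>g\<close> is trapped between the intervals for \<open>c = |f(x)| - \<epsilon>\<close> and \<open>c = |f(x)| + \<epsilon>\<close>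
  up to a part of \<open>{t \<ge> \<delta>}\<close>. Multiplied by \<open>\<lambda>\<^bsup>q\<^esup>\<close>, the weight of that part vanishes in the limit:
  it is empty for large \<open>\<lambda>\<close> if \<open>\<gamma> > 0\<close>, and has weight at most \<open>\<delta>\<^bsup>\<gamma>\<^esup> / |\<gamma>|\<close> if \<open>\<gamma> < 0\<close>.
\<close>

section \<open>Level sets of functions and of constants\<close>

definition superlevel :: "real \<Rightarrow> real \<Rightarrow> (real \<Rightarrow> 'b::real_normed_vector) \<Rightarrow> real \<Rightarrow> real set"
  where "superlevel \<gamma> q g l = {t. t > 0 \<and> norm (g t) > l * t powr (\<gamma> / q)}"

definition sublevel :: "real \<Rightarrow> real \<Rightarrow> real \<Rightarrow> real \<Rightarrow> real set"
  where "sublevel \<gamma> q c l = {t. t > 0 \<and> l * t powr (\<gamma> / q) < c}"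

section \<open>Weighted measure of sets and intervals\<close>

lemma wmeas_mono: "E \<subseteq> F \<Longrightarrow> wmeas \<gamma> E \<le> wmeas \<gamma> F"
  unfolding wmeas_def by (intro nn_integral_mono) (auto split: split_indicator)

text \<open>Both sets are taken measurable because \<open>wmeas\<close> acts as an inner measure on
  other sets, and inner measures are not subadditive.\<close>

lemma wmeas_Un_le:
  assumes "E \<in> sets lebesgue" "F \<in> sets lebesgue"
  shows "wmeas \<gamma> (E \<union> F) \<le> wmeas \<gamma> E + wmeas \<gamma> F"
proof -
  have m: "(\<lambda>t. ennreal (t powr (\<gamma> - 1))) \<in> borel_measurable lebesgue"
    by (intro measurable_completion) measurable
  have "wmeas \<gamma> (E \<union> F) \<le> (\<integral>\<^sup>+ t. ennreal (t powr (\<gamma> - 1)) * indicator E t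
      + ennreal (t powr (\<gamma> - 1)) * indicator F t \<partial>lebesgue)"
    unfolding wmeas_def by (intro nn_integral_mono) (auto split: split_indicator)
  also have "\<dots> = wmeas \<gamma> E + wmeas \<gamma> F"
    unfolding wmeas_def using m assms
    by (intro nn_integral_add borel_measurable_times_ennreal borel_measurable_indicator)
  finally show ?thesis .
qed

text \<open>The integrand is nonnegative, so gauge integrals computed from antiderivatives give the
  nonnegative integral. Passing from \<open>lebesgue\<close> to \<open>lborel\<close> does not
  change its value.\<close>

lemma wmeas_has_integral:
  assumes "((\<lambda>t. t powr (\<gamma> - 1)) has_integral I) E" "I \<ge> 0"
  shows "wmeas \<gamma> E = ennreal I"
proof -
  have "(\<integral>\<^sup>+ t. ennreal (indicator E t * t powr (\<gamma> - 1)) \<partial>lborel) = ennreal I"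
    using assms by (intro nn_integral_has_integral_lebesgue) auto
  moreover have "wmeas \<gamma> E = (\<integral>\<^sup>+ t. ennreal (indicator E t * t powr (\<gamma> - 1)) \<partial>lborel)"
    unfolding wmeas_def nn_integral_completion
    by (intro nn_integral_cong) (auto split: split_indicator)
  ultimately show ?thesis by simp
qed

text \<open>The exponent \<open>\<gamma> - 1\<close> exceeds -1 exactly when \<gamma> > 0, so the
  weight is then integrable at 0. For \<gamma> < 0 it is integrable at infinity instead, hence the
  half-lines in the next two lemmas.\<close>

lemma wmeas_Ioo_0:
  assumes "\<gamma> > 0" "s \<ge> 0"
  shows "wmeas \<gamma> {0<..<s} = ennreal (s powr \<gamma> / \<gamma>)"
proof (rule wmeas_has_integral)
  have "((\<lambda>t. t powr (\<gamma> - 1)) has_integral s powr (\<gamma> - 1 + 1) / (\<gamma> - 1 + 1)) {0..s}"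
    using assms by (intro has_integral_powr_from_0) auto
  then show "((\<lambda>t. t powr (\<gamma> - 1)) has_integral s powr \<gamma> / \<gamma>) {0<..<s}"
    by (simp add: has_integral_Icc_iff_Ioo)
qed (use assms in auto)

lemma wmeas_atLeast:
  assumes "\<gamma> < 0" "s > 0"
  shows "wmeas \<gamma> {s..} = ennreal (s powr \<gamma> / (- \<gamma>))"
proof (rule wmeas_has_integral)
  show "((\<lambda>t. t powr (\<gamma> - 1)) has_integral s powr \<gamma> / (- \<gamma>)) {s..}"
    using has_integral_powr_to_inf[of "\<gamma> - 1" s] assms by simp
qed (use assms in \<open>simp add: divide_nonneg_neg\<close>)

lemma wmeas_greaterThan:
  assumes "\<gamma> < 0" "s > 0"
  shows "wmeas \<gamma> {s<..} = ennreal (s powr \<gamma> / (- \<gamma>))"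
proof (rule wmeas_has_integral)
  have "((\<lambda>t. t powr (\<gamma> - 1)) has_integral s powr \<gamma> / (- \<gamma>)) {s..}"
    using has_integral_powr_to_inf[of "\<gamma> - 1" s] assms by simp
  moreover have "((\<lambda>t. t powr (\<gamma> - 1)) has_integral I) {s..} \<longleftrightarrow>
      ((\<lambda>t. t powr (\<gamma> - 1)) has_integral I) {s<..}" for I
    by (intro has_integral_spike_set_eq negligible_subset[OF negligible_sing[of s]]) auto
  ultimately show "((\<lambda>t. t powr (\<gamma> - 1)) has_integral s powr \<gamma> / (- \<gamma>)) {s<..}"
    by simp
qed (use assms in \<open>simp add: divide_nonneg_neg\<close>)

section \<open>Level sets of constants as intervals\<close>

lemma sublevel_eq_pos:
  assumes "\<gamma> > 0" "q > 0" "l > 0" "c > 0"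
  shows "sublevel \<gamma> q c l = {0<..<(c / l) powr (q / \<gamma>)}"
proof -
  have "l * t powr (\<gamma> / q) < c \<longleftrightarrow> t < (c / l) powr (q / \<gamma>)" if "t > 0" for t
  proof -
    have "l * t powr (\<gamma> / q) < c \<longleftrightarrow> t powr (\<gamma> / q) < c / l"
      using assms by (simp add: field_simps)
    also have "c / l = ((c / l) powr (q / \<gamma>)) powr (\<gamma> / q)"
      using assms by (simp add: powr_powr)
    also have "t powr (\<gamma> / q) < \<dots> \<longleftrightarrow> t < (c / l) powr (q / \<gamma>)"
      using assms that powr_less_mono2[of "\<gamma> / q"] by (smt (verit) divide_pos_pos powr_ge_zero)
    finally show ?thesis .
  qed
  then show ?thesis by (auto simp: sublevel_def)
qed

lemma sublevel_eq_neg: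
  assumes "\<gamma> < 0" "q > 0" "l > 0" "c > 0"
  shows "sublevel \<gamma> q c l = {(c / l) powr (q / \<gamma>)<..}"
proof -
  have "l * t powr (\<gamma> / q) < c \<longleftrightarrow> (c / l) powr (q / \<gamma>) < t" if "t > 0" for t
  proof -
    have "l * t powr (\<gamma> / q) < c \<longleftrightarrow> t powr (\<gamma> / q) < c / l"
      using assms by (simp add: field_simps)
    also have "\<dots> \<longleftrightarrow> (\<gamma> / q) * ln t < ln (c / l)"
      using assms that by (subst ln_less_cancel_iff[symmetric]) (auto simp: ln_powr)
    \<comment> \<open>The factor \<open>q / \<gamma>\<close> is negative, so multiplying by it
      reverses the inequality; this turns the bounded interval of the positive case into a
      half-line.\<close>
    also have "\<dots> \<longleftrightarrow> (q / \<gamma>) * ln (c / l) < ln t"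
      using assms by (simp add: field_simps)
    also have "\<dots> \<longleftrightarrow> (c / l) powr (q / \<gamma>) < t"
      using assms that by (subst ln_less_cancel_iff[symmetric]) (auto simp: ln_powr)
    finally show ?thesis .
  qed
  moreover have "0 < t" if "(c / l) powr (q / \<gamma>) < t" for t
    using that powr_ge_zero[of "c / l" "q / \<gamma>"] by linarith
  ultimately show ?thesis by (auto simp: sublevel_def)
qed

lemma sublevel_nonpos: "l > 0 \<Longrightarrow> c \<le> 0 \<Longrightarrow> sublevel \<gamma> q c l = {}"
  unfolding sublevel_def
  by (auto simp: not_less intro: order_trans[of _ 0])

lemma sets_sublevel: "sublevel \<gamma> q c l \<in> sets lebesgue"
proof -
  have "sublevel \<gamma> q c l \<in> sets borel"
    unfolding sublevel_def by measurable
  then show ?thesis by (auto intro: sets_completionI_sets)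
qed

lemma wmeas_empty [simp]: "wmeas \<gamma> {} = 0"
  by (simp add: wmeas_def)

text \<open>The endpoint \<open>(c / l) powr (q / \<gamma>)\<close> raised to the power \<gamma> is
  \<open>(c / l) powr q\<close> for either sign of \<gamma>, so one formula covers both kinds of
  interval. For \<open>c = 0\<close> the set is empty and \<open>0 powr q\<close> is 0.\<close>

lemma wmeas_sublevel:
  assumes "\<gamma> \<noteq> 0" "q > 0" "l > 0" "c \<ge> 0"
  shows "wmeas \<gamma> (sublevel \<gamma> q c l) = ennreal ((c / l) powr q / \<bar>\<gamma>\<bar>)"
proof (cases "c = 0")
  case True
  then show ?thesis using assms by (simp add: sublevel_nonpos)
next
  case False
  with assms consider "\<gamma> > 0" "c > 0" | "\<gamma> < 0" "c > 0" by linarith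
  then show ?thesis
  proof cases
    case 1
    with assms show ?thesis by (simp add: sublevel_eq_pos wmeas_Ioo_0 powr_powr)
  next
    case 2
    with assms show ?thesis by (simp add: sublevel_eq_neg wmeas_greaterThan powr_powr)
  qed
qed

section \<open>Bounds at a fixed level\<close>

lemma superlevel_subset_sublevel:
  assumes "\<And>t. t > 0 \<Longrightarrow> norm (g t) \<le> B"
  shows "superlevel \<gamma> q g l \<subseteq> sublevel \<gamma> q B l"
  using assms unfolding superlevel_def sublevel_def by (auto intro: less_le_trans)

lemma wmeas_superlevel_le:
  assumes "\<gamma> \<noteq> 0" "q > 0" "l > 0" "B \<ge> 0" "\<And>t. t > 0 \<Longrightarrow> norm (g t) \<le> B"
  shows "wmeas \<gamma> (superlevel \<gamma> q g l) \<le> ennreal ((B / l) powr q / \<bar>\<gamma>\<bar>)"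
  using wmeas_mono[OF superlevel_subset_sublevel[of g B \<gamma> q l], of \<gamma>] assms
  by (simp add: wmeas_sublevel)

text \<open>The factor \<open>l\<close> moves under the root as \<open>l powr q\<close>. Finiteness
  rules out the infinite branch of \<open>ennpowr\<close>, so limits can be taken among real
  numbers.\<close>

lemma weak_quantity_eq:
  assumes "q > 0" "l > 0" "wmeas \<gamma> (superlevel \<gamma> q g l) < \<infinity>"
  shows "weak_quantity \<gamma> q g l =
    ennreal ((l powr q * enn2real (wmeas \<gamma> (superlevel \<gamma> q g l))) powr (1 / q))"
  using assms unfolding weak_quantity_def superlevel_def[symmetric] ennpowr_def
  by (simp add: powr_mult powr_powr ennreal_mult)

text \<open>Comparison with the constant \<open>B\<close>, for which the normalised quantity equals
  \<open>B\<close> at every level \<open>l\<close>.\<close>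

lemma weak_quantity_le:
  assumes "\<gamma> \<noteq> 0" "q > 0" "l > 0" "B \<ge> 0" "\<And>t. t > 0 \<Longrightarrow> norm (g t) \<le> B"
  shows "ennreal (\<bar>\<gamma>\<bar> powr (1 / q)) * weak_quantity \<gamma> q g l \<le> ennreal B"
proof -
  let ?w = "wmeas \<gamma> (superlevel \<gamma> q g l)"
  have le: "?w \<le> ennreal ((B / l) powr q / \<bar>\<gamma>\<bar>)"
    by (rule wmeas_superlevel_le) (use assms in auto)
  then have fin: "?w < \<infinity>"
    using le_less_trans by fastforce
  have "enn2real ?w \<le> (B / l) powr q / \<bar>\<gamma>\<bar>"
    using le by (intro enn2real_leI) auto
  then have "l powr q * enn2real ?w \<le> l powr q * ((B / l) powr q / \<bar>\<gamma>\<bar>)"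
    by (intro mult_left_mono) auto
  also have "\<dots> = B powr q / \<bar>\<gamma>\<bar>"
    using assms by (simp add: powr_divide)
  finally have "(l powr q * enn2real ?w) powr (1 / q) \<le> (B powr q / \<bar>\<gamma>\<bar>) powr (1 / q)"
    using assms by (intro powr_mono2) auto
  also have "\<dots> = B / \<bar>\<gamma>\<bar> powr (1 / q)"
    using assms by (simp add: powr_divide powr_powr)
  finally have "\<bar>\<gamma>\<bar> powr (1 / q) * (l powr q * enn2real ?w) powr (1 / q) \<le> B"
    using assms by (simp add: field_simps)
  then show ?thesis
    using assms fin by (simp add: weak_quantity_eq ennreal_mult[symmetric] ennreal_leI)
qed

section \<open>The limit in the level\<close>

text \<open>A single filter lets both limits be proved at once. For either sign of \<gamma> and
  \<open>c > 0\<close>, the endpoint \<open>(c / l) powr (q / \<gamma>)\<close> tends to 0 along it,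
  which is why only the behaviour of \<open>g\<close> near 0 survives.\<close>

definition limit_filter :: "real \<Rightarrow> real filter"
  where "limit_filter \<gamma> = (if \<gamma> > 0 then at_top else at_right 0)"

lemma eventually_limit_filter_pos: "eventually (\<lambda>l. l > 0) (limit_filter \<gamma>)"
  by (auto simp: limit_filter_def eventually_gt_at_top eventually_at_right_less)

lemma limit_filter_neq_bot: "limit_filter \<gamma> \<noteq> bot"
  by (simp add: limit_filter_def)

lemma sublevel_tail_tendsto_0:
  assumes "\<gamma> \<noteq> 0" "q > 0" "\<delta> > 0"
  shows "((\<lambda>l. l powr q * enn2real (wmeas \<gamma> (sublevel \<gamma> q B l \<inter> {\<delta>..}))) \<longlongrightarrow> 0)
    (limit_filter \<gamma>)"
proof (cases "\<gamma> > 0")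
  case True
  \<comment> \<open>The threshold is the level at which \<open>l * t powr (\<gamma> / q)\<close>
    equals \<open>B\<close> at \<open>t = \<delta>\<close>. Above it the increasing power exceeds
    \<open>B\<close> on all of \<open>{\<delta>..}\<close>; the maximum with 0 keeps
    \<open>l\<close> positive for the monotonicity step.\<close>
  have "eventually (\<lambda>l. l > max 0 (B / \<delta> powr (\<gamma> / q))) at_top"
    by (rule eventually_gt_at_top)
  then have "eventually (\<lambda>l. l powr q * enn2real (wmeas \<gamma> (sublevel \<gamma> q B l \<inter> {\<delta>..})) = 0) at_top"
  proof eventually_elim
    case (elim l)
    have False if "t \<ge> \<delta>" "l * t powr (\<gamma> / q) < B" for t
    proof -
      have "B < l * \<delta> powr (\<gamma> / q)"
        using elim assms by (simp add: field_simps)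
      also have "\<dots> \<le> l * t powr (\<gamma> / q)"
        using that elim assms True by (intro mult_left_mono powr_mono2) auto
      finally show False using that by simp
    qed
    then have "sublevel \<gamma> q B l \<inter> {\<delta>..} = {}"
      by (auto simp: sublevel_def)
    then show ?case by simp
  qed
  with True show ?thesis
    by (simp add: limit_filter_def tendsto_eventually)
next
  case False
  with assms have neg: "\<gamma> < 0" by simp
  \<comment> \<open>The bound is uniform in \<open>l\<close>, so the factor \<open>l powr q\<close>
    alone forces convergence to 0.\<close>
  have le: "enn2real (wmeas \<gamma> (sublevel \<gamma> q B l \<inter> {\<delta>..})) \<le> \<delta> powr \<gamma> / (- \<gamma>)" for l
  proof (rule enn2real_leI)
    show "wmeas \<gamma> (sublevel \<gamma> q B l \<inter> {\<delta>..}) \<le> ennreal (\<delta> powr \<gamma> / (- \<gamma>))"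
      using wmeas_mono[of "sublevel \<gamma> q B l \<inter> {\<delta>..}" "{\<delta>..}" \<gamma>] wmeas_atLeast[OF neg \<open>\<delta> > 0\<close>]
      by simp
  qed (use neg in \<open>simp add: divide_nonneg_neg\<close>)
  have "((\<lambda>l. l powr q) \<longlongrightarrow> 0 powr q) (at_right 0)"
    using assms by (intro tendsto_powr' tendsto_ident_at tendsto_const)
      (auto simp: eventually_at_filter)
  then have "((\<lambda>l. l powr q * (\<delta> powr \<gamma> / (- \<gamma>))) \<longlongrightarrow> 0) (at_right 0)"
    using tendsto_mult_left_zero by fastforce
  then have "((\<lambda>l. l powr q * enn2real (wmeas \<gamma> (sublevel \<gamma> q B l \<inter> {\<delta>..}))) \<longlongrightarrow> 0) (at_right 0)"
    by (rule tendsto_sandwich[OF _ _ tendsto_const, rotated 2])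
      (intro always_eventually allI mult_left_mono le mult_nonneg_nonneg powr_ge_zero enn2real_nonneg)+
  with False show ?thesis by (simp add: limit_filter_def)
qed

lemma superlevel_trapped:
  assumes bd: "\<And>t. t > 0 \<Longrightarrow> norm (g t) \<le> B" and "\<delta> > 0"
    and near: "\<And>t. 0 < t \<Longrightarrow> t < \<delta> \<Longrightarrow> \<bar>norm (g t) - A\<bar> < \<epsilon>"
  shows "superlevel \<gamma> q g l \<subseteq> sublevel \<gamma> q (A + \<epsilon>) l \<union> (sublevel \<gamma> q B l \<inter> {\<delta>..})"
    and "sublevel \<gamma> q (A - \<epsilon>) l - (sublevel \<gamma> q B l \<inter> {\<delta>..}) \<subseteq> superlevel \<gamma> q g l"
proof -
  show "superlevel \<gamma> q g l \<subseteq> sublevel \<gamma> q (A + \<epsilon>) l \<union> (sublevel \<gamma> q B l \<inter> {\<delta>..})"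
  proof
    fix t assume t: "t \<in> superlevel \<gamma> q g l"
    then show "t \<in> sublevel \<gamma> q (A + \<epsilon>) l \<union> (sublevel \<gamma> q B l \<inter> {\<delta>..})"
      using bd[of t] near[of t] unfolding superlevel_def sublevel_def
      by (cases "t < \<delta>") auto
  qed
  \<comment> \<open>At \<open>\<delta> / 2\<close> both estimates on \<open>g\<close> apply. Hence
    every \<open>t \<ge> \<delta>\<close> in the level set for \<open>A - \<epsilon>\<close> also
    lies in the one for \<open>B\<close> and is removed by the set difference, leaving only points
    where \<open>near\<close> applies.\<close>
  have AB: "A - \<epsilon> \<le> B"
    using bd[of "\<delta> / 2"] near[of "\<delta> / 2"] \<open>\<delta> > 0\<close> by simp
  show "sublevel \<gamma> q (A - \<epsilon>) l - (sublevel \<gamma> q B l \<inter> {\<delta>..}) \<subseteq> superlevel \<gamma> q g l"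
  proof
    fix t assume t: "t \<in> sublevel \<gamma> q (A - \<epsilon>) l - (sublevel \<gamma> q B l \<inter> {\<delta>..})"
    then show "t \<in> superlevel \<gamma> q g l"
      using AB near[of t] unfolding superlevel_def sublevel_def
      by (cases "t < \<delta>") auto
  qed
qed

text \<open>The two inclusions become real inequalities with a common tail error \<open>R\<close>.
  Truncating \<open>A - \<epsilon>\<close> at 0 makes \<open>wmeas_sublevel\<close> applicable and
  does not change the level set, which is empty for nonpositive constants.\<close>

lemma wmeas_superlevel_bounds:
  assumes "\<gamma> \<noteq> 0" "q > 0" "l > 0" "\<delta> > 0" "A \<ge> 0" "\<epsilon> > 0"
    and bd: "\<And>t. t > 0 \<Longrightarrow> norm (g t) \<le> B"
    and near: "\<And>t. 0 < t \<Longrightarrow> t < \<delta> \<Longrightarrow> \<bar>norm (g t) - A\<bar> < \<epsilon>"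
  defines "R \<equiv> l powr q * enn2real (wmeas \<gamma> (sublevel \<gamma> q B l \<inter> {\<delta>..}))"
  defines "W \<equiv> l powr q * enn2real (wmeas \<gamma> (superlevel \<gamma> q g l))"
  shows "W \<le> (A + \<epsilon>) powr q / \<bar>\<gamma>\<bar> + R"
    and "max 0 (A - \<epsilon>) powr q / \<bar>\<gamma>\<bar> - R \<le> W"
proof -
  define T where "T = sublevel \<gamma> q B l \<inter> {\<delta>..}"
  define E where "E = superlevel \<gamma> q g l"
  have B: "B \<ge> 0"
    using bd[of 1] norm_ge_zero[of "g 1"] by linarith
  have T [measurable]: "T \<in> sets lebesgue"
    unfolding T_def by (intro sets.Int sets_sublevel) auto
  \<comment> \<open>The factor \<open>l powr q\<close> removes the level from the weight of a
    constant's level set, so that all dependence on \<open>l\<close> in the bounds sits in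
    \<open>R\<close>.\<close>
  have scale: "l powr q * ((c / l) powr q / \<bar>\<gamma>\<bar>) = c powr q / \<bar>\<gamma>\<bar>" if "c \<ge> 0" for c
    using that assms(1-3) by (simp add: powr_divide)
  have "wmeas \<gamma> T \<le> ennreal ((B / l) powr q / \<bar>\<gamma>\<bar>)"
    using wmeas_mono[of T "sublevel \<gamma> q B l" \<gamma>] wmeas_sublevel[of \<gamma> q l B] assms(1-3) B
    by (simp add: T_def)
  then have T': "wmeas \<gamma> T = ennreal (enn2real (wmeas \<gamma> T))"
    using le_less_trans[OF _ ennreal_less_top] by (intro ennreal_enn2real[symmetric]) auto
  have "wmeas \<gamma> E \<le> ennreal ((B / l) powr q / \<bar>\<gamma>\<bar>)"
    unfolding E_def using assms(1-3) B bd by (intro wmeas_superlevel_le) auto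
  then have E': "wmeas \<gamma> E = ennreal (enn2real (wmeas \<gamma> E))"
    using le_less_trans[OF _ ennreal_less_top] by (intro ennreal_enn2real[symmetric]) auto

  have "wmeas \<gamma> E \<le> wmeas \<gamma> (sublevel \<gamma> q (A + \<epsilon>) l \<union> T)"
    unfolding E_def T_def using superlevel_trapped(1)[OF bd assms(4) near] by (intro wmeas_mono) auto
  also have "\<dots> \<le> wmeas \<gamma> (sublevel \<gamma> q (A + \<epsilon>) l) + wmeas \<gamma> T"
    by (intro wmeas_Un_le sets_sublevel T)
  also have "\<dots> = ennreal (((A + \<epsilon>) / l) powr q / \<bar>\<gamma>\<bar> + enn2real (wmeas \<gamma> T))"
    using assms(1-6) by (subst T') (simp add: wmeas_sublevel ennreal_plus)
  finally have "enn2real (wmeas \<gamma> E) \<le> ((A + \<epsilon>) / l) powr q / \<bar>\<gamma>\<bar> + enn2real (wmeas \<gamma> T)"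
    by (intro enn2real_leI) auto
  from mult_left_mono[OF this, of "l powr q"]
  show "W \<le> (A + \<epsilon>) powr q / \<bar>\<gamma>\<bar> + R"
    using scale[of "A + \<epsilon>"] assms(1,5,6)
    by (simp add: W_def R_def E_def T_def distrib_left)

  \<comment> \<open>\<open>E\<close> need not be measurable, so subadditivity is applied to \<open>?S - T\<close> instead of \<open>E\<close>.\<close>
  let ?S = "sublevel \<gamma> q (max 0 (A - \<epsilon>)) l"
  have "?S - T \<subseteq> E"
    using superlevel_trapped(2)[OF bd assms(4) near, where \<gamma> = \<gamma> and q = q and l = l]
      sublevel_nonpos[OF assms(3), of 0 \<gamma> q]
    unfolding E_def T_def by (cases "A - \<epsilon> \<le> 0") (auto simp: max_def)
  then have "wmeas \<gamma> (?S - T) \<le> wmeas \<gamma> E"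
    by (rule wmeas_mono)
  have "wmeas \<gamma> ?S \<le> wmeas \<gamma> ((?S - T) \<union> T)"
    by (intro wmeas_mono) auto
  also have "\<dots> \<le> wmeas \<gamma> (?S - T) + wmeas \<gamma> T"
    by (intro wmeas_Un_le sets.Diff sets_sublevel T)
  also have "\<dots> \<le> wmeas \<gamma> E + wmeas \<gamma> T"
    using \<open>wmeas \<gamma> (?S - T) \<le> wmeas \<gamma> E\<close> by (rule add_right_mono)
  also have "\<dots> = ennreal (enn2real (wmeas \<gamma> E) + enn2real (wmeas \<gamma> T))"
    by (subst T', subst E') (simp add: ennreal_plus)
  finally have "(max 0 (A - \<epsilon>) / l) powr q / \<bar>\<gamma>\<bar> \<le> enn2real (wmeas \<gamma> E) + enn2real (wmeas \<gamma> T)"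
    using assms(1-3) by (subst (asm) wmeas_sublevel) (auto simp flip: ennreal_plus)
  from mult_left_mono[OF this, of "l powr q"]
  show "max 0 (A - \<epsilon>) powr q / \<bar>\<gamma>\<bar> - R \<le> W"
    using scale[of "max 0 (A - \<epsilon>)"] assms(1)
    by (simp add: W_def R_def E_def T_def distrib_left)
qed

text \<open>The choices are made in the order \<epsilon>, \<delta>, \<open>l\<close>: continuity of
  the power gives \<epsilon>, the limit of \<open>g\<close> gives \<delta>, and for this fixed
  \<delta> the tail is eventually small.\<close>

lemma scaled_wmeas_tendsto:
  assumes "\<gamma> \<noteq> 0" "q > 0"
    and bd: "\<And>t. t > 0 \<Longrightarrow> norm (g t) \<le> B"
    and lim: "(g \<longlongrightarrow> a) (at_right 0)"
  shows "((\<lambda>l. l powr q * enn2real (wmeas \<gamma> (superlevel \<gamma> q g l))) \<longlongrightarrow> norm a powr q / \<bar>\<gamma>\<bar>)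
    (limit_filter \<gamma>)"
proof -
  define W where "W l = l powr q * enn2real (wmeas \<gamma> (superlevel \<gamma> q g l))" for l
  define R where "R \<delta> l = l powr q * enn2real (wmeas \<gamma> (sublevel \<gamma> q B l \<inter> {\<delta>..}))" for \<delta> l
  have near: "\<exists>\<delta>>0. \<forall>t. 0 < t \<longrightarrow> t < \<delta> \<longrightarrow> \<bar>norm (g t) - norm a\<bar> < \<epsilon>" if "\<epsilon> > 0" for \<epsilon>
    using tendstoD[OF tendsto_norm[OF lim] that]
    by (auto simp: eventually_at_right_field dist_real_def)
  have R0: "(R \<delta> \<longlongrightarrow> 0) (limit_filter \<gamma>)" if "\<delta> > 0" for \<delta>
    unfolding R_def using assms(1,2) that by (rule sublevel_tail_tendsto_0)
  have "(W \<longlongrightarrow> norm a powr q / \<bar>\<gamma>\<bar>) (limit_filter \<gamma>)"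
  proof (rule order_tendstoI)
    fix y assume y: "y < norm a powr q / \<bar>\<gamma>\<bar>"
    \<comment> \<open>Since \<open>q > 0\<close>, the power is continuous at base 0 as well, so
      \<open>a = 0\<close> needs no separate case.\<close>
    have "((\<lambda>\<epsilon>. max 0 (norm a - \<epsilon>) powr q / \<bar>\<gamma>\<bar>) \<longlongrightarrow> max 0 (norm a - 0) powr q / \<bar>\<gamma>\<bar>)
        (at_right 0)"
      using assms(1,2) by (intro tendsto_intros tendsto_powr') auto
    then have "eventually (\<lambda>\<epsilon>. y < max 0 (norm a - \<epsilon>) powr q / \<bar>\<gamma>\<bar>) (at_right 0)"
      using y by (intro order_tendstoD(1)) auto
    moreover have "eventually (\<lambda>\<epsilon>::real. \<epsilon> > 0) (at_right 0)"
      by (rule eventually_at_right_less)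
    ultimately have "eventually (\<lambda>\<epsilon>. \<epsilon> > 0 \<and> y < max 0 (norm a - \<epsilon>) powr q / \<bar>\<gamma>\<bar>) (at_right 0)"
      by eventually_elim auto
    then obtain \<epsilon> where \<epsilon>: "\<epsilon> > 0" "y < max 0 (norm a - \<epsilon>) powr q / \<bar>\<gamma>\<bar>"
      using eventually_happens[of _ "at_right (0::real)"] by auto
    obtain \<delta> where \<delta>: "\<delta> > 0" "\<And>t. 0 < t \<Longrightarrow> t < \<delta> \<Longrightarrow> \<bar>norm (g t) - norm a\<bar> < \<epsilon>"
      using near[OF \<epsilon>(1)] by blast
    \<comment> \<open>The strict gap left by the choice of \<epsilon> is the room allowed to the
      tail.\<close>
    have "eventually (\<lambda>l. R \<delta> l < max 0 (norm a - \<epsilon>) powr q / \<bar>\<gamma>\<bar> - y) (limit_filter \<gamma>)"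
      using \<epsilon> by (intro order_tendstoD(2)[OF R0[OF \<delta>(1)]]) auto
    then show "eventually (\<lambda>l. y < W l) (limit_filter \<gamma>)"
      using eventually_limit_filter_pos[of \<gamma>]
    proof eventually_elim
      case (elim l)
      have "max 0 (norm a - \<epsilon>) powr q / \<bar>\<gamma>\<bar> - R \<delta> l \<le> W l"
        unfolding R_def W_def
        using assms(1,2) elim(2) \<delta>(1) \<epsilon>(1) bd \<delta>(2) by (intro wmeas_superlevel_bounds(2)) auto
      with elim show ?case by linarith
    qed
  next
    fix y assume y: "norm a powr q / \<bar>\<gamma>\<bar> < y"
    have "((\<lambda>\<epsilon>. (norm a + \<epsilon>) powr q / \<bar>\<gamma>\<bar>) \<longlongrightarrow> (norm a + 0) powr q / \<bar>\<gamma>\<bar>) (at_right 0)"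
      using assms(1,2)
      by (intro tendsto_intros tendsto_powr') (auto simp: eventually_at_filter)
    then have "eventually (\<lambda>\<epsilon>. (norm a + \<epsilon>) powr q / \<bar>\<gamma>\<bar> < y) (at_right 0)"
      using y by (intro order_tendstoD(2)) auto
    moreover have "eventually (\<lambda>\<epsilon>::real. \<epsilon> > 0) (at_right 0)"
      by (rule eventually_at_right_less)
    ultimately have "eventually (\<lambda>\<epsilon>. \<epsilon> > 0 \<and> (norm a + \<epsilon>) powr q / \<bar>\<gamma>\<bar> < y) (at_right 0)"
      by eventually_elim auto
    then obtain \<epsilon> where \<epsilon>: "\<epsilon> > 0" "(norm a + \<epsilon>) powr q / \<bar>\<gamma>\<bar> < y"
      using eventually_happens[of _ "at_right (0::real)"] by auto
    obtain \<delta> where \<delta>: "\<delta> > 0" "\<And>t. 0 < t \<Longrightarrow> t < \<delta> \<Longrightarrow> \<bar>norm (g t) - norm a\<bar> < \<epsilon>"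
      using near[OF \<epsilon>(1)] by blast
    have "eventually (\<lambda>l. R \<delta> l < y - (norm a + \<epsilon>) powr q / \<bar>\<gamma>\<bar>) (limit_filter \<gamma>)"
      using \<epsilon> by (intro order_tendstoD(2)[OF R0[OF \<delta>(1)]]) auto
    then show "eventually (\<lambda>l. W l < y) (limit_filter \<gamma>)"
      using eventually_limit_filter_pos[of \<gamma>]
    proof eventually_elim
      case (elim l)
      have "W l \<le> (norm a + \<epsilon>) powr q / \<bar>\<gamma>\<bar> + R \<delta> l"
        unfolding R_def W_def
        using assms(1,2) elim(2) \<delta>(1) \<epsilon>(1) bd \<delta>(2) by (intro wmeas_superlevel_bounds(1)) auto
      with elim show ?case by linarith
    qed
  qed
  then show ?thesis unfolding W_def .
qed

text \<open>This is the \<open>q\<close>-th root of the preceding limit. The real formula for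
  \<open>weak_quantity\<close> holds for \<open>l > 0\<close>, hence eventually along the
  filter.\<close>

lemma weak_quantity_tendsto:
  assumes "\<gamma> \<noteq> 0" "q > 0"
    and bd: "\<And>t. t > 0 \<Longrightarrow> norm (g t) \<le> B"
    and lim: "(g \<longlongrightarrow> a) (at_right 0)"
  shows "(weak_quantity \<gamma> q g \<longlongrightarrow> ennreal (norm a / \<bar>\<gamma>\<bar> powr (1 / q))) (limit_filter \<gamma>)"
proof -
  have B: "B \<ge> 0"
    using bd[of 1] norm_ge_zero[of "g 1"] by linarith
  have "((\<lambda>l. (l powr q * enn2real (wmeas \<gamma> (superlevel \<gamma> q g l))) powr (1 / q))
      \<longlongrightarrow> (norm a powr q / \<bar>\<gamma>\<bar>) powr (1 / q)) (limit_filter \<gamma>)"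
    using assms by (intro tendsto_powr' scaled_wmeas_tendsto[OF assms(1,2) bd lim] tendsto_const) auto
  also have "(norm a powr q / \<bar>\<gamma>\<bar>) powr (1 / q) = norm a / \<bar>\<gamma>\<bar> powr (1 / q)"
    using assms(1,2) by (simp add: powr_divide powr_powr)
  finally have "((\<lambda>l. ennreal ((l powr q * enn2real (wmeas \<gamma> (superlevel \<gamma> q g l))) powr (1 / q)))
      \<longlongrightarrow> ennreal (norm a / \<bar>\<gamma>\<bar> powr (1 / q))) (limit_filter \<gamma>)"
    by (rule tendsto_ennrealI)
  moreover have "eventually (\<lambda>l. weak_quantity \<gamma> q g l =
      ennreal ((l powr q * enn2real (wmeas \<gamma> (superlevel \<gamma> q g l))) powr (1 / q))) (limit_filter \<gamma>)"
    using eventually_limit_filter_pos[of \<gamma>]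
  proof eventually_elim
    case (elim l)
    have "wmeas \<gamma> (superlevel \<gamma> q g l) \<le> ennreal ((B / l) powr q / \<bar>\<gamma>\<bar>)"
      using assms(1,2) elim B bd by (intro wmeas_superlevel_le) auto
    then have "wmeas \<gamma> (superlevel \<gamma> q g l) < \<infinity>"
      using le_less_trans by fastforce
    with assms(2) elim show ?case by (rule weak_quantity_eq)
  qed
  ultimately show ?thesis
    using tendsto_cong by force
qed

text \<open>The supremum dominates the values along the filter and hence their limit, which gives
  the lower bound. The upper bound holds level by level.\<close>

lemma weak_quantity_SUP_bounds:
  assumes "\<gamma> \<noteq> 0" "q > 0"
    and bd: "\<And>t. t > 0 \<Longrightarrow> norm (g t) \<le> B"
    and lim: "(g \<longlongrightarrow> a) (at_right 0)"
  shows "ennreal (norm a) \<le> ennreal (\<bar>\<gamma>\<bar> powr (1 / q)) * (SUP l \<in> {0<..}. weak_quantity \<gamma> q g l)"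
    and "ennreal (\<bar>\<gamma>\<bar> powr (1 / q)) * (SUP l \<in> {0<..}. weak_quantity \<gamma> q g l) \<le> ennreal B"
proof -
  have B: "B \<ge> 0"
    using bd[of 1] norm_ge_zero[of "g 1"] by linarith
  have "ennreal (norm a / \<bar>\<gamma>\<bar> powr (1 / q)) \<le> (SUP l \<in> {0<..}. weak_quantity \<gamma> q g l)"
  proof (rule tendsto_upperbound[OF weak_quantity_tendsto[OF assms] _ limit_filter_neq_bot])
    show "eventually (\<lambda>l. weak_quantity \<gamma> q g l \<le> (SUP l \<in> {0<..}. weak_quantity \<gamma> q g l))
        (limit_filter \<gamma>)"
      using eventually_limit_filter_pos[of \<gamma>]
      by eventually_elim (auto intro: SUP_upper)
  qed
  then have "ennreal (\<bar>\<gamma>\<bar> powr (1 / q)) * ennreal (norm a / \<bar>\<gamma>\<bar> powr (1 / q))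
      \<le> ennreal (\<bar>\<gamma>\<bar> powr (1 / q)) * (SUP l \<in> {0<..}. weak_quantity \<gamma> q g l)"
    by (rule mult_left_mono) simp
  then show "ennreal (norm a) \<le>
      ennreal (\<bar>\<gamma>\<bar> powr (1 / q)) * (SUP l \<in> {0<..}. weak_quantity \<gamma> q g l)"
    using assms(1) by (simp add: ennreal_mult[symmetric])
  show "ennreal (\<bar>\<gamma>\<bar> powr (1 / q)) * (SUP l \<in> {0<..}. weak_quantity \<gamma> q g l) \<le> ennreal B"
    unfolding SUP_mult_left_ennreal
    using assms(1,2) B bd by (intro SUP_least weak_quantity_le) auto
qed

section \<open>Application to convolutions at a fixed point\<close>

theorem theorem1p5:
  fixes K :: "real \<Rightarrow> real ^ 'n \<Rightarrow> 'b::{real_normed_field, banach, second_countable_topology}"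
    and f :: "real ^ 'n \<Rightarrow> 'b"
    and x :: "real ^ 'n"
  assumes "\<And>t. t > 0 \<Longrightarrow> integrable lebesgue (K t)"
    and "locally_integrable f"
    and "lebesgue_point f x"
    and "((\<lambda>t. conv (K t) f x) \<longlongrightarrow> f x) (at_right 0)"
    and "(SUP t \<in> {0<..}. ennreal (norm (conv (K t) f x))) < \<infinity>"
  shows "\<forall>\<gamma> q. \<gamma> \<noteq> 0 \<and> q > 0 \<longrightarrow>
      (\<gamma> > 0 \<longrightarrow> (\<exists>L. (weak_quantity \<gamma> q (\<lambda>t. conv (K t) f x) \<longlongrightarrow> L) at_top \<and>
        ennreal (norm (f x)) = ennreal (\<gamma> powr (1 / q)) * L)) \<and>
      (\<gamma> < 0 \<longrightarrow> (\<exists>L. (weak_quantity \<gamma> q (\<lambda>t. conv (K t) f x) \<longlongrightarrow> L) (at_right 0) \<and>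
        ennreal (norm (f x)) = ennreal ((- \<gamma>) powr (1 / q)) * L)) \<and>
      (\<forall>C::real. C \<ge> 0 \<and>
        (SUP t \<in> {0<..}. ennreal (norm (conv (K t) f x))) \<le> ennreal C * HL_maximal f x \<longrightarrow>
          ennreal (norm (f x)) \<le> ennreal (\<bar>\<gamma>\<bar> powr (1 / q)) *
            (SUP l \<in> {0<..}. weak_quantity \<gamma> q (\<lambda>t. conv (K t) f x) l) \<and>
          ennreal (\<bar>\<gamma>\<bar> powr (1 / q)) *
            (SUP l \<in> {0<..}. weak_quantity \<gamma> q (\<lambda>t. conv (K t) f x) l)
            \<le> ennreal C * HL_maximal f x)"
proof -
  define g where "g t = conv (K t) f x" for t
  let ?M = "SUP t \<in> {0<..}. ennreal (norm (g t))"
  \<comment> \<open>The supremum itself serves as the bound \<open>B\<close>. The upper estimate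
    then ends exactly at \<open>?M\<close>, where the assumed comparison with
    \<open>HL_maximal\<close> takes over.\<close>
  have M: "ennreal (enn2real ?M) = ?M"
    using assms(5) unfolding g_def by (intro ennreal_enn2real) simp
  have bd: "norm (g t) \<le> enn2real ?M" if "t > 0" for t
  proof -
    have "ennreal (norm (g t)) \<le> ennreal (enn2real ?M)"
      unfolding M using that by (intro SUP_upper) auto
    then show ?thesis by simp
  qed
  have lim: "(g \<longlongrightarrow> f x) (at_right 0)"
    using assms(4) unfolding g_def[symmetric] .
  \<comment> \<open>Dividing \<open>norm (f x)\<close> by the normalising constant gives the
    witness. The sign of \<gamma> later resolves both the absolute value and the filter.\<close>
  have limit: "\<exists>L. (weak_quantity \<gamma> q g \<longlongrightarrow> L) (limit_filter \<gamma>) \<and>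
      ennreal (norm (f x)) = ennreal (\<bar>\<gamma>\<bar> powr (1 / q)) * L" if "\<gamma> \<noteq> 0" "q > 0" for \<gamma> q
    using weak_quantity_tendsto[OF that bd lim] that(1)
    by (intro exI[of _ "ennreal (norm (f x) / \<bar>\<gamma>\<bar> powr (1 / q))"])
      (simp add: ennreal_mult[symmetric])
  show ?thesis
    unfolding g_def[symmetric]
  proof (intro allI impI conjI; elim conjE)
    fix \<gamma> q :: real assume \<gamma>q: "\<gamma> \<noteq> 0" "q > 0"
    show "\<exists>L. (weak_quantity \<gamma> q g \<longlongrightarrow> L) at_top \<and>
        ennreal (norm (f x)) = ennreal (\<gamma> powr (1 / q)) * L" if "\<gamma> > 0"
      using limit[OF \<gamma>q] that by (simp add: limit_filter_def)
    show "\<exists>L. (weak_quantity \<gamma> q g \<longlongrightarrow> L) (at_right 0) \<and>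
        ennreal (norm (f x)) = ennreal ((- \<gamma>) powr (1 / q)) * L" if "\<gamma> < 0"
      using limit[OF \<gamma>q] that by (simp add: limit_filter_def)
    fix C :: real assume C: "?M \<le> ennreal C * HL_maximal f x"
    show "ennreal (norm (f x)) \<le>
        ennreal (\<bar>\<gamma>\<bar> powr (1 / q)) * (SUP l \<in> {0<..}. weak_quantity \<gamma> q g l)"
      by (rule weak_quantity_SUP_bounds(1)[OF \<gamma>q bd lim])
    show "ennreal (\<bar>\<gamma>\<bar> powr (1 / q)) * (SUP l \<in> {0<..}. weak_quantity \<gamma> q g l)
        \<le> ennreal C * HL_maximal f x"
      using weak_quantity_SUP_bounds(2)[OF \<gamma>q bd lim] C unfolding M by (rule order_trans)
  qed
qed

end
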